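(* Let $X$ be a Delone set of finite type in $\mathbb{R}^n$. The following conditions are equivalent. (i) $[[X]]$ is translation-minimal. (ii) The topological dynamical system $(\mathcal{X}_X,\mathbb{R}^n)$ is minimal; that is, $\mathcal{X}_X=[[X]]$. (iii) $X$ is repetitive.
   Context: A Delone set in $\mathbb{R}^n$ is a set $X\subset\mathbb{R}^n$ for which there are $r,R>0$ such that each open ball of radius $r$ contains at most one point of $X$ and each closed ball of radius $R$ contains at least one point of $X$. $X$ is of finite type if $X-X$ meets every bounded set in a finite set. $B(\mathbf{x};T)$ is the closed ball of radius $T$ centered at $\mathbf{x}$. The $T$-atlas of $X$ is $\mathcal{A}_X(T)=\{(X\cap B(\mathbf{x};T))-\mathbf{x}:\mathbf{x}\in X\}$, and the atlas is $\mathcal{A}_X=\bigcup_{T>0}\mathcal{A}_X(T)$. The local isomorphism class $[[X]]$ of $X$ is the collection of Delone sets $Y$ with $\mathcal{A}_Y=\mathcal{A}_X$. Local isomorphism classes of Delone sets are partially ordered by $[[X']]\le_{\mathcal{T}}[[X]]$ iff $\mathcal{A}_{X'}\subseteq\mathcal{A}_X$; $[[X]]$ (or $X$) is translation-minimal if $[[X]]$ is a minimal element of this partial order. $X$ is repetitive if for each $T>0$ there is a finite $M>0$ such that every closed ball of radius $M$ in $\mathbb{R}^n$ contains, for every $\mathcal{P}\in\mathcal{A}_X(T)$, some $\mathbf{x}\in X$ with $(X\cap B(\mathbf{x};T))-\mathbf{x}=\mathcal{P}$. The natural topology on the collection of closed subsets of $\mathbb{R}^n$: for an integer $k\ge1$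 and closed $F_1,F_2$ put $d_k(F_1,F_2)=\inf(\{\delta: F_1\cap B(\mathbf{0};k)\subset F_2+B(\mathbf{0};\delta),\ F_2\cap B(\mathbf{0};k)\subset F_1+B(\mathbf{0};\delta)\}\cup\{1\})$; a basis of neighborhoods of a closed set $F$ is given by the sets $\{F': d_k(F,F')<\epsilon\}$ for $k\in\mathbb{Z}^+$, $\epsilon>0$. $\mathcal{X}_X$ is the closure in this topology of the orbit $\{X+\mathbf{t}:\mathbf{t}\in\mathbb{R}^n\}$, with $\mathbb{R}^n$ acting by translation (it consists of Delone sets). The system $(\mathcal{X}_X,\mathbb{R}^n)$ is minimal if $\mathcal{X}_Y=\mathcal{X}_X$ for each $Y\in\mathcal{X}_X$, equivalently every orbit in $\mathcal{X}_X$ is dense in $\mathcal{X}_X$. *)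

theory Defs
  imports "HOL-Analysis.Analysis"
begin

section \<open>Delone sets\<close>

definition delone :: "'a::euclidean_space set \<Rightarrow> bool" where
  "delone X \<longleftrightarrow> (\<exists>r>0. \<exists>R>0.
     (\<forall>c. \<forall>x\<in>X \<inter> ball c r. \<forall>y\<in>X \<inter> ball c r. x = y) \<and>
     (\<forall>c. X \<inter> cball c R \<noteq> {}))"

text \<open>The difference set is written out, since \<open>X - X\<close> on sets is the set-theoretic difference.\<close>

definition finite_type :: "'a::euclidean_space set \<Rightarrow> bool" where
  "finite_type X \<longleftrightarrow> (\<forall>B. bounded B \<longrightarrow> finite ({x - y | x y. x \<in> X \<and> y \<in> X} \<inter> B))"


section \<open>Atlases and local isomorphism classes\<close>

definition patch :: "'a::euclidean_space set \<Rightarrow> 'a \<Rightarrow> real \<Rightarrow> 'a set" where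
  "patch X x T = (\<lambda>y. y - x) ` (X \<inter> cball x T)"

definition atlas_at :: "'a::euclidean_space set \<Rightarrow> real \<Rightarrow> 'a set set" where
  "atlas_at X T = {patch X x T | x. x \<in> X}"

definition atlas :: "'a::euclidean_space set \<Rightarrow> 'a set set" where
  "atlas X = (\<Union>T\<in>{0<..}. atlas_at X T)"

definition li_class :: "'a::euclidean_space set \<Rightarrow> 'a set set" where
  "li_class X = {Y. delone Y \<and> atlas Y = atlas X}"

definition li_classes :: "'a::euclidean_space set set set" where
  "li_classes = li_class ` {X. delone X}"

definition li_le :: "'a::euclidean_space set set \<Rightarrow> 'a set set \<Rightarrow> bool" where
  "li_le C' C \<longleftrightarrow> (\<exists>X' X. delone X' \<and> delone X \<and> C' = li_class X' \<and> C = li_class X \<and>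
                      atlas X' \<subseteq> atlas X)"

lemma li_class_eq_iff:
  assumes "delone X" "delone Y"
  shows "li_class X = li_class Y \<longleftrightarrow> atlas X = atlas Y"
  using assms unfolding li_class_def by auto

lemma li_le_li_class_iff:
  assumes "delone X'" "delone X"
  shows "li_le (li_class X') (li_class X) \<longleftrightarrow> atlas X' \<subseteq> atlas X"
proof
  assume "li_le (li_class X') (li_class X)"
  then obtain Z' Z where "delone Z'" "delone Z" "li_class X' = li_class Z'"
    "li_class X = li_class Z" "atlas Z' \<subseteq> atlas Z"
    unfolding li_le_def by blast
  with assms show "atlas X' \<subseteq> atlas X"
    by (simp add: li_class_eq_iff)
next
  assume "atlas X' \<subseteq> atlas X"
  with assms show "li_le (li_class X') (li_class X)"
    unfolding li_le_def by blast
qed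

definition translation_minimal :: "'a::euclidean_space set set \<Rightarrow> bool" where
  "translation_minimal C \<longleftrightarrow> C \<in> li_classes \<and> (\<forall>C'\<in>li_classes. li_le C' C \<longrightarrow> C' = C)"

definition repetitive :: "'a::euclidean_space set \<Rightarrow> bool" where
  "repetitive X \<longleftrightarrow> (\<forall>T>0. \<exists>M>0. \<forall>c. \<forall>P\<in>atlas_at X T. \<exists>x\<in>X \<inter> cball c M. patch X x T = P)"


section \<open>The natural topology on closed sets\<close>

text \<open>In \<open>local_dist\<close> only \<open>\<delta> > 0\<close> is admitted: otherwise, for two sets missing the ball of
  radius \<open>k\<close>, every negative \<open>\<delta>\<close> would qualify and the real infimum would be unspecified.
  The sum of sets is the Minkowski sum.\<close>

definition local_close :: "nat \<Rightarrow> 'a::euclidean_space set \<Rightarrow> 'a set \<Rightarrow> real \<Rightarrow> bool" where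
  "local_close k F G \<delta> \<longleftrightarrow>
     F \<inter> cball 0 (real k) \<subseteq> G + cball 0 \<delta> \<and> G \<inter> cball 0 (real k) \<subseteq> F + cball 0 \<delta>"

definition local_dist :: "nat \<Rightarrow> 'a::euclidean_space set \<Rightarrow> 'a set \<Rightarrow> real" where
  "local_dist k F G = Inf ({\<delta>. 0 < \<delta> \<and> local_close k F G \<delta>} \<union> {1})"

definition basic_nbhd :: "'a::euclidean_space set \<Rightarrow> nat \<Rightarrow> real \<Rightarrow> 'a set set" where
  "basic_nbhd F k \<epsilon> = {G. closed G \<and> local_dist k F G < \<epsilon>}"

definition natural_topology :: "'a::euclidean_space set topology" where
  "natural_topology = topology (\<lambda>U. U \<subseteq> {F. closed F} \<and>
     (\<forall>F\<in>U. \<exists>k\<ge>1. \<exists>\<epsilon>>0. basic_nbhd F k \<epsilon> \<subseteq> U))"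

text \<open>The next lemmas show that this is a topology on the collection of closed sets, for which the
  sets \<open>basic_nbhd F k \<epsilon>\<close> do form a basis of neighborhoods of \<open>F\<close>.\<close>

lemma local_dist_less_iff:
  "local_dist k F G < \<epsilon> \<longleftrightarrow> 1 < \<epsilon> \<or> (\<exists>\<delta>. 0 < \<delta> \<and> \<delta> < \<epsilon> \<and> local_close k F G \<delta>)"
proof -
  have "bdd_below ({\<delta>. 0 < \<delta> \<and> local_close k F G \<delta>} \<union> {1})"
    by (rule bdd_belowI[of _ 0]) auto
  then show ?thesis
    unfolding local_dist_def by (subst cInf_less_iff) auto
qed

lemma minkowski_cball_iff:
  fixes x :: "'a::euclidean_space"
  shows "x \<in> G + cball 0 \<delta> \<longleftrightarrow> (\<exists>y\<in>G. dist x y \<le> \<delta>)"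
proof
  assume "x \<in> G + cball 0 \<delta>"
  then obtain a b where "a \<in> G" "norm b \<le> \<delta>" "x = a + b"
    by (auto simp: set_plus_def)
  then show "\<exists>y\<in>G. dist x y \<le> \<delta>"
    by (intro bexI[of _ a]) (simp_all add: dist_norm)
next
  assume "\<exists>y\<in>G. dist x y \<le> \<delta>"
  then obtain y where "y \<in> G" "dist x y \<le> \<delta>" by blast
  then have "y + (x - y) \<in> G + cball 0 \<delta>"
    by (intro set_plus_intro) (auto simp: dist_norm norm_minus_commute)
  then show "x \<in> G + cball 0 \<delta>" by simp
qed

lemma basic_nbhd_mono:
  assumes "k \<le> k'" "\<epsilon>' \<le> \<epsilon>"
  shows "basic_nbhd F k' \<epsilon>' \<subseteq> basic_nbhd F k \<epsilon>"
proof -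
  have "cball (0::'a) (real k) \<subseteq> cball 0 (real k')"
    using assms(1) by auto
  then have "local_close k' F G \<delta> \<Longrightarrow> local_close k F G \<delta>" for G \<delta>
    unfolding local_close_def by blast
  then show ?thesis
    using assms(2) unfolding basic_nbhd_def local_dist_less_iff by force
qed

lemma istopology_natural:
  "istopology (\<lambda>U. U \<subseteq> {F::'a::euclidean_space set. closed F} \<and>
     (\<forall>F\<in>U. \<exists>k\<ge>1. \<exists>\<epsilon>>0. basic_nbhd F k \<epsilon> \<subseteq> U))" (is "istopology ?L")
  unfolding istopology_def
proof (intro conjI allI impI)
  fix S T assume S: "?L S" and T: "?L T"
  have "\<exists>k\<ge>1. \<exists>\<epsilon>>0. basic_nbhd F k \<epsilon> \<subseteq> S \<inter> T" if FST: "F \<in> S \<inter> T" for F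
  proof -
    obtain k \<epsilon> where 1: "k \<ge> 1" "\<epsilon> > 0" "basic_nbhd F k \<epsilon> \<subseteq> S"
      using S FST by blast
    obtain k' \<epsilon>' where 2: "k' \<ge> 1" "\<epsilon>' > 0" "basic_nbhd F k' \<epsilon>' \<subseteq> T"
      using T FST by blast
    have "basic_nbhd F (max k k') (min \<epsilon> \<epsilon>') \<subseteq> S \<inter> T"
      using 1(3) 2(3) basic_nbhd_mono[of k "max k k'" "min \<epsilon> \<epsilon>'" \<epsilon> F]
        basic_nbhd_mono[of k' "max k k'" "min \<epsilon> \<epsilon>'" \<epsilon>' F] by auto
    moreover have "max k k' \<ge> 1" "min \<epsilon> \<epsilon>' > 0" using 1 2 by auto
    ultimately show ?thesis by blast
  qed
  then show "\<forall>F\<in>S \<inter> T. \<exists>k\<ge>1. \<exists>\<epsilon>>0. basic_nbhd F k \<epsilon> \<subseteq> S \<inter> T" by (rule ballI)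
  show "S \<inter> T \<subseteq> {F. closed F}" using S by auto
next
  fix K assume K: "\<forall>S\<in>K. ?L S"
  then show "\<Union>K \<subseteq> {F. closed F}" by (simp add: Sup_le_iff)
  show "\<forall>F\<in>\<Union>K. \<exists>k\<ge>1. \<exists>\<epsilon>>0. basic_nbhd F k \<epsilon> \<subseteq> \<Union>K"
  proof
    fix F assume "F \<in> \<Union>K"
    then obtain S where "S \<in> K" "F \<in> S" by blast
    then obtain k \<epsilon> where "k \<ge> 1" "\<epsilon> > 0" "basic_nbhd F k \<epsilon> \<subseteq> S" using K by blast
    with \<open>S \<in> K\<close> show "\<exists>k\<ge>1. \<exists>\<epsilon>>0. basic_nbhd F k \<epsilon> \<subseteq> \<Union>K" by blast
  qed
qed

lemma openin_natural_topology:
  "openin natural_topology U \<longleftrightarrow> U \<subseteq> {F. closed F} \<and>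
     (\<forall>F\<in>U. \<exists>k\<ge>1. \<exists>\<epsilon>>0. basic_nbhd F k \<epsilon> \<subseteq> U)"
  unfolding natural_topology_def topology_inverse'[OF istopology_natural] ..

lemma topspace_natural_topology: "topspace natural_topology = {F. closed F}"
proof
  show "topspace natural_topology \<subseteq> {F. closed F}"
    using openin_topspace[of natural_topology] unfolding openin_natural_topology by blast
  have "openin natural_topology {F::'a set. closed F}"
    unfolding openin_natural_topology basic_nbhd_def by (auto intro!: exI[of _ 1])
  then show "{F::'a set. closed F} \<subseteq> topspace natural_topology"
    by (rule openin_subset)
qed

lemma basic_nbhd_self:
  assumes "closed F" "\<epsilon> > 0"
  shows "F \<in> basic_nbhd F k \<epsilon>"
proof -
  have "local_close k F F (\<epsilon> / 2)"
    using assms(2) unfolding local_close_def subset_iff minkowski_cball_iff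
    by (auto intro!: bexI)
  then have "local_dist k F F < \<epsilon>"
    using assms(2) unfolding local_dist_less_iff by (intro disjI2 exI[of _ "\<epsilon> / 2"]) auto
  then show ?thesis using assms(1) by (simp add: basic_nbhd_def)
qed

lemma local_close_trans:
  assumes "local_close (Suc k) F G \<delta>" "local_close (Suc k) G H \<eta>" "\<delta> \<le> 1" "\<eta> \<le> 1"
  shows "local_close k F H (\<delta> + \<eta>)"
proof -
  have step: "A \<inter> cball 0 (real k) \<subseteq> C + cball 0 (a + b)"
    if "A \<inter> cball 0 (real (Suc k)) \<subseteq> B + cball 0 a" "B \<inter> cball 0 (real (Suc k)) \<subseteq> C + cball 0 b"
      "a \<le> 1" for A B C :: "'a set" and a b
  proof
    fix x assume x: "x \<in> A \<inter> cball 0 (real k)"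
    then have "x \<in> A \<inter> cball 0 (real (Suc k))" by auto
    with that(1) obtain y where y: "y \<in> B" "dist x y \<le> a"
      using minkowski_cball_iff by blast
    have "dist 0 y \<le> dist 0 x + dist x y" by (rule dist_triangle)
    with x y that(3) have "y \<in> B \<inter> cball 0 (real (Suc k))" by auto
    with that(2) obtain z where z: "z \<in> C" "dist y z \<le> b"
      using minkowski_cball_iff by blast
    have "dist x z \<le> a + b" using dist_triangle[of x z y] y z by linarith
    with z show "x \<in> C + cball 0 (a + b)" unfolding minkowski_cball_iff by blast
  qed
  from assms step[of F G \<delta> H \<eta>] step[of H G \<eta> F \<delta>] show ?thesis
    unfolding local_close_def by (simp add: add.commute)
qed

lemma basic_nbhd_trans:
  assumes "\<epsilon> \<le> 1" "G \<in> basic_nbhd F (Suc k) (\<epsilon> / 2)"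
  shows "basic_nbhd G (Suc k) (\<epsilon> / 2) \<subseteq> basic_nbhd F k \<epsilon>"
proof
  fix H assume H: "H \<in> basic_nbhd G (Suc k) (\<epsilon> / 2)"
  obtain \<delta> where d: "0 < \<delta>" "\<delta> < \<epsilon> / 2" "local_close (Suc k) F G \<delta>"
    using assms unfolding basic_nbhd_def local_dist_less_iff by auto
  obtain \<eta> where e: "0 < \<eta>" "\<eta> < \<epsilon> / 2" "local_close (Suc k) G H \<eta>"
    using H assms(1) unfolding basic_nbhd_def local_dist_less_iff by auto
  have "local_close k F H (\<delta> + \<eta>)"
    using local_close_trans[OF d(3) e(3)] d(2) e(2) assms(1) by linarith
  moreover have "0 < \<delta> + \<eta>" "\<delta> + \<eta> < \<epsilon>" using d(1,2) e(1,2) by linarith+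
  ultimately have "local_dist k F H < \<epsilon>" unfolding local_dist_less_iff by blast
  with H show "H \<in> basic_nbhd F k \<epsilon>" by (simp add: basic_nbhd_def)
qed

lemma natural_topology_nbhd_basis:
  assumes "closed F"
  shows "(\<exists>U. openin natural_topology U \<and> F \<in> U \<and> U \<subseteq> N) \<longleftrightarrow>
         (\<exists>k\<ge>1. \<exists>\<epsilon>>0. basic_nbhd F k \<epsilon> \<subseteq> N)"
proof
  assume "\<exists>U. openin natural_topology U \<and> F \<in> U \<and> U \<subseteq> N"
  then obtain U where "openin natural_topology U" "F \<in> U" "U \<subseteq> N" by blast
  then show "\<exists>k\<ge>1. \<exists>\<epsilon>>0. basic_nbhd F k \<epsilon> \<subseteq> N"
    unfolding openin_natural_topology by (meson subset_trans)
next
  assume N: "\<exists>k\<ge>1. \<exists>\<epsilon>>0. basic_nbhd F k \<epsilon> \<subseteq> N"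
  define U where "U = {G. closed G \<and> (\<exists>k\<ge>1. \<exists>\<epsilon>>0. basic_nbhd G k \<epsilon> \<subseteq> N)}"
  have "\<exists>k\<ge>1. \<exists>\<epsilon>>0. basic_nbhd G k \<epsilon> \<subseteq> U" if GU: "G \<in> U" for G
  proof -
    obtain k \<epsilon> where k: "k \<ge> 1" "\<epsilon> > 0" "basic_nbhd G k \<epsilon> \<subseteq> N"
      using GU unfolding U_def by blast
    define e where "e = min \<epsilon> 1"
    have e: "e > 0" "e \<le> 1" using k(2) by (auto simp: e_def)
    have sub: "basic_nbhd G k e \<subseteq> N"
      using basic_nbhd_mono[of k k e \<epsilon> G] k(3) by (auto simp: e_def)
    have pos: "Suc k \<ge> 1" "e / 2 > 0" using e by auto
    have "basic_nbhd G (Suc k) (e / 2) \<subseteq> U"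
    proof
      fix H assume H: "H \<in> basic_nbhd G (Suc k) (e / 2)"
      then have "closed H" by (simp add: basic_nbhd_def)
      moreover have "basic_nbhd H (Suc k) (e / 2) \<subseteq> N"
        using basic_nbhd_trans[OF e(2) H] sub by blast
      ultimately show "H \<in> U" unfolding U_def using pos by blast
    qed
    with pos show ?thesis by blast
  qed
  then have "openin natural_topology U"
    unfolding openin_natural_topology U_def by blast
  moreover have "F \<in> U" using assms N unfolding U_def by blast
  moreover have "U \<subseteq> N" unfolding U_def using basic_nbhd_self by blast
  ultimately show "\<exists>U. openin natural_topology U \<and> F \<in> U \<and> U \<subseteq> N" by blast
qed


section \<open>The translation dynamical system\<close>

definition translation_orbit :: "'a::euclidean_space set \<Rightarrow> 'a set set" where
  "translation_orbit X = range (\<lambda>t. (\<lambda>x. x + t) ` X)"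

definition orbit_closure :: "'a::euclidean_space set \<Rightarrow> 'a set set" where
  "orbit_closure X = natural_topology closure_of translation_orbit X"

definition minimal_system :: "'a::euclidean_space set \<Rightarrow> bool" where
  "minimal_system X \<longleftrightarrow> (\<forall>Y\<in>orbit_closure X. orbit_closure Y = orbit_closure X)"

end

theory Submission
  imports Defs
begin

text \<open>For \<open>X\<close> Delone of finite type, the orbit closure of \<open>X\<close> consists of the Delone sets \<open>Y\<close> with
  \<open>\<A>\<^sub>Y \<subseteq> \<A>\<^sub>X\<close>: limits satisfy \<open>Y - Y \<subseteq> X - X\<close>, and since \<open>X - X\<close> is locally finite, closeness of
  two patches up to a small error forces equality. Hence the first two conditions all say that
  \<open>\<A>\<^sub>Y \<subseteq> \<A>\<^sub>X\<close> implies \<open>\<A>\<^sub>Y = \<A>\<^sub>X\<close>. Repetitivity gives this at once, because every large patch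
  of \<open>Y\<close> is a patch of \<open>X\<close> and so contains all small patches of \<open>X\<close>. Conversely, if \<open>X\<close> is not
  repetitive, then some patch \<open>P\<close> is missing from arbitrarily large balls; as there are only
  finitely many patches of each radius, Koenig's lemma applied to the patches around the centres of
  these balls yields a Delone set \<open>Y\<close> with \<open>\<A>\<^sub>Y \<subseteq> \<A>\<^sub>X\<close> in which \<open>P\<close> does not occur.\<close>

section \<open>Delone sets and patches in pointwise terms\<close>

lemma delone_iff:
  fixes X :: "'a::euclidean_space set"
  shows "delone X \<longleftrightarrow> (\<exists>r>0. \<forall>x\<in>X. \<forall>y\<in>X. dist x y < r \<longrightarrow> x = y) \<and> (\<exists>R>0. \<forall>c. \<exists>x\<in>X. dist c x \<le> R)"
    (is "_ \<longleftrightarrow> ?A \<and> ?B")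
proof
  assume "delone X"
  then obtain r R where rR: "r > 0" "R > 0"
    and sep: "\<And>c x y. x \<in> X \<inter> ball c r \<Longrightarrow> y \<in> X \<inter> ball c r \<Longrightarrow> x = y"
    and dense: "\<And>c. X \<inter> cball c R \<noteq> {}"
    unfolding delone_def by blast
  have "\<forall>x\<in>X. \<forall>y\<in>X. dist x y < r \<longrightarrow> x = y"
    using sep rR(1) by (metis IntI centre_in_ball mem_ball)
  moreover have "\<forall>c. \<exists>x\<in>X. dist c x \<le> R"
    using dense by (metis IntE all_not_in_conv mem_cball)
  ultimately show "?A \<and> ?B" using rR by blast
next
  assume "?A \<and> ?B"
  then obtain r R where rR: "r > 0" "R > 0"
    and sep: "\<And>x y. x \<in> X \<Longrightarrow> y \<in> X \<Longrightarrow> dist x y < r \<Longrightarrow> x = y"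
    and dense: "\<And>c. \<exists>x\<in>X. dist c x \<le> R" by blast
  \<comment> \<open>Halving the radius: by the triangle inequality two points of such a ball are
    less than \<open>r\<close> apart.\<close>
  have "x = y" if "x \<in> X \<inter> ball c (r/2)" "y \<in> X \<inter> ball c (r/2)" for c x y
    using that dist_triangle_half_r[of c x r y] sep by auto
  moreover have "X \<inter> cball c R \<noteq> {}" for c using dense[of c] by auto
  ultimately show "delone X" unfolding delone_def using rR
    by (intro exI[of _ "r/2"] conjI exI[of _ R]) auto
qed

lemma delone_imp_closed:
  assumes "delone X"
  shows "closed X"
proof -
  obtain r where "r > 0" "\<forall>x\<in>X. \<forall>y\<in>X. dist x y < r \<longrightarrow> x = y"
    using assms unfolding delone_iff by blast
  then show ?thesis by (intro discrete_imp_closed[of r]) (auto simp: dist_commute)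
qed

lemma delone_nonempty: "delone X \<Longrightarrow> X \<noteq> {}"
  unfolding delone_iff by blast

lemma mem_patch_iff: "v \<in> patch X x T \<longleftrightarrow> x + v \<in> X \<and> norm v \<le> T"
proof -
  have "v \<in> patch X x T \<longleftrightarrow> (\<exists>y\<in>X. dist x y \<le> T \<and> v = y - x)"
    unfolding patch_def by auto
  also have "\<dots> \<longleftrightarrow> x + v \<in> X \<and> norm v \<le> T"
    by (auto simp: dist_norm norm_minus_commute intro!: bexI[of _ "x + v"])
  finally show ?thesis .
qed

lemma patch_eq_iff:
  "patch X x T = patch Y y T \<longleftrightarrow> (\<forall>v. norm v \<le> T \<longrightarrow> (x + v \<in> X \<longleftrightarrow> y + v \<in> Y))"
  unfolding set_eq_iff mem_patch_iff by auto

lemma patch_Int_cball: "S \<le> T \<Longrightarrow> patch X x T \<inter> cball 0 S = patch X x S"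
  by (auto simp: mem_patch_iff)

text \<open>The ball of radius \<open>S\<close> about \<open>v\<close> lies inside the ball of
  radius \<open>T\<close> about 0. The new centre \<open>x + v\<close> need not be a point of
  \<open>X\<close>.\<close>

lemma patch_eq_subpatch:
  fixes v :: "'a::euclidean_space"
  assumes "patch X x T = patch Y y T" "norm v + S \<le> T"
  shows "patch X (x + v) S = patch Y (y + v) S"
  unfolding patch_eq_iff
proof (intro allI impI)
  fix w :: 'a assume "norm w \<le> S"
  then have "norm (v + w) \<le> T" using norm_triangle_ineq[of v w] assms(2) by linarith
  then show "x + v + w \<in> X \<longleftrightarrow> y + v + w \<in> Y"
    using assms(1) unfolding patch_eq_iff add.assoc by blast
qed

text \<open>Elements of the atlas do not remember their radius. It is recovered by enlarging the patch of
  \<open>X'\<close> until it has a point outside the ball of radius \<open>T\<close>.\<close>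

lemma atlas_subset_iff:
  fixes X X' :: "'a::euclidean_space set"
  assumes "delone X'"
  shows "atlas X' \<subseteq> atlas X \<longleftrightarrow> (\<forall>T>0. atlas_at X' T \<subseteq> atlas_at X T)"
proof (intro iffI allI impI subsetI)
  fix T :: real and P
  assume sub: "atlas X' \<subseteq> atlas X" and T: "T > 0" and "P \<in> atlas_at X' T"
  then obtain x where x: "x \<in> X'" "P = patch X' x T" unfolding atlas_at_def by blast
  obtain R where R: "R > 0" "\<And>c. \<exists>x\<in>X'. dist c x \<le> R"
    using assms unfolding delone_iff by blast
  \<comment> \<open>The length \<open>T + R + 1\<close> keeps every point within \<open>R\<close> of
    \<open>x + u\<close> at distance more than \<open>T\<close> from \<open>x\<close>.\<close>
  obtain u :: 'a where u: "norm u = T + R + 1"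
    using vector_choose_size[of "T + R + 1"] T R(1) by auto
  obtain z where z: "z \<in> X'" "dist (x + u) z \<le> R" using R(2) by blast
  have "u = (z - x) + (x + u - z)" by simp
  then have "norm u \<le> norm (z - x) + dist (x + u) z"
    unfolding dist_norm by (metis norm_triangle_ineq)
  then have far: "norm (z - x) > T" using u z(2) by linarith
  define T' where "T' = norm (z - x)"
  have "patch X' x T' \<in> atlas X'"
    using x(1) T far unfolding atlas_def atlas_at_def T'_def by fastforce
  then obtain y S where y: "y \<in> X" "patch X' x T' = patch X y S"
    using sub unfolding atlas_def atlas_at_def by blast
  have "z - x \<in> patch X' x T'" using z(1) by (simp add: mem_patch_iff T'_def)
  \<comment> \<open>Nothing is known about \<open>S\<close> beforehand; the element
    \<open>z - x\<close> forces \<open>S > T\<close>, so both patches can be cut down to radius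
    \<open>T\<close>.\<close>
  then have "norm (z - x) \<le> S" unfolding y(2) mem_patch_iff by blast
  then have "patch X' x T = patch X y T"
    using patch_Int_cball[of T T' X' x] patch_Int_cball[of T S X y] far y(2)
    unfolding T'_def by simp
  then show "P \<in> atlas_at X T" using x y unfolding atlas_at_def by blast
qed (auto simp: atlas_def)

section \<open>Finiteness of patches and rigidity of differences\<close>

text \<open>A patch centred at a point of \<open>X\<close> consists of differences of norm at most
  \<open>T\<close>, and a finite set has finitely many subsets. This feeds the pigeonhole arguments
  below.\<close>

lemma finite_atlas_at:
  assumes "finite_type X"
  shows "finite (atlas_at X T)"
proof (rule finite_subset)
  show "atlas_at X T \<subseteq> Pow ({x - y | x y. x \<in> X \<and> y \<in> X} \<inter> cball 0 T)"
  proof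
    fix P assume "P \<in> atlas_at X T"
    then obtain x where x: "x \<in> X" "P = patch X x T" unfolding atlas_at_def by blast
    have "\<exists>a b. v = a - b \<and> a \<in> X \<and> b \<in> X" if "x + v \<in> X" for v
      using that x(1) by (metis add_diff_cancel_left')
    then show "P \<in> Pow ({x - y | x y. x \<in> X \<and> y \<in> X} \<inter> cball 0 T)"
      unfolding x(2) by (auto simp: mem_patch_iff)
  qed
  show "finite (Pow ({x - y | x y. x \<in> X \<and> y \<in> X} \<inter> cball 0 T))"
    using assms unfolding finite_type_def by (intro finite_Pow_iff[THEN iffD2]) simp
qed

lemma finite_type_subset:
  assumes "finite_type X"
    and "\<And>x y. x \<in> Y \<Longrightarrow> y \<in> Y \<Longrightarrow> \<exists>a\<in>X. \<exists>b\<in>X. x - y = a - b"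
  shows "finite_type Y"
  unfolding finite_type_def
proof (intro allI impI)
  fix B :: "'a set" assume "bounded B"
  then have "finite ({x - y | x y. x \<in> X \<and> y \<in> X} \<inter> B)"
    using assms(1) unfolding finite_type_def by blast
  moreover have "{x - y | x y. x \<in> Y \<and> y \<in> Y} \<inter> B \<subseteq> {x - y | x y. x \<in> X \<and> y \<in> X} \<inter> B"
    using assms(2) by blast
  ultimately show "finite ({x - y | x y. x \<in> Y \<and> y \<in> Y} \<inter> B)" by (rule finite_subset[rotated])
qed

text \<open>One patch around \<open>y\<close> is large enough to show \<open>x\<close>, and this
  patch recurs in \<open>X\<close>. Together with \<open>finite_type_subset\<close> it passes finite
  type from \<open>X\<close> to \<open>Y\<close>.\<close>

lemma atlas_subset_imp_differences:
  assumes "delone Y" "atlas Y \<subseteq> atlas X" "x \<in> Y" "y \<in> Y"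
  shows "\<exists>a\<in>X. \<exists>b\<in>X. x - y = a - b"
proof -
  define T where "T = norm (x - y) + 1"
  have T: "T > 0" "norm (x - y) \<le> T" by (auto simp: T_def add_nonneg_pos)
  then have "patch Y y T \<in> atlas_at X T"
    using assms unfolding atlas_subset_iff[OF assms(1)] atlas_at_def by blast
  then obtain b where b: "b \<in> X" "patch Y y T = patch X b T" unfolding atlas_at_def by blast
  have "x - y \<in> patch Y y T" using assms(3) T by (simp add: mem_patch_iff)
  then have "b + (x - y) \<in> X" unfolding b(2) mem_patch_iff by blast
  with b(1) show ?thesis by (metis add_diff_cancel_left')
qed

text \<open>Distinct elements of a finite set have a least distance, found here by keeping the
  nonzero second differences away from 0. It turns approximate into exact agreement of
  patches.\<close>

lemma close_differences_eq:
  assumes "finite_type X"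
  shows "\<exists>d>0. \<forall>u\<in>{x - y | x y. x \<in> X \<and> y \<in> X} \<inter> cball 0 K.
           \<forall>v\<in>{x - y | x y. x \<in> X \<and> y \<in> X} \<inter> cball 0 K. dist u v < d \<longrightarrow> u = v"
proof -
  define D where "D = {x - y | x y. x \<in> X \<and> y \<in> X} \<inter> cball 0 K"
  have "finite D" using assms unfolding D_def finite_type_def by simp
  then have "finite ((\<lambda>(u, v). u - v) ` (D \<times> D))" by simp
  then obtain d where d: "d > 0" "\<forall>w\<in>(\<lambda>(u, v). u - v) ` (D \<times> D). w \<noteq> 0 \<longrightarrow> d \<le> dist 0 w"
    using finite_set_avoid[of _ 0] by blast
  have "u = v" if "u \<in> D" "v \<in> D" "dist u v < d" for u v
    using d(2) that by (force simp: dist_norm)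
  then show ?thesis using d(1) unfolding D_def by blast
qed

section \<open>The orbit closure described by atlases\<close>

lemma delone_translate:
  assumes "delone X"
  shows "delone ((\<lambda>x. x + t) ` X)"
proof -
  obtain r R where "r > 0" "R > 0"
    "\<forall>x\<in>X. \<forall>y\<in>X. dist x y < r \<longrightarrow> x = y" and R: "\<And>c. \<exists>x\<in>X. dist c x \<le> R"
    using assms unfolding delone_iff by blast
  moreover have "\<exists>x\<in>(\<lambda>x. x + t) ` X. dist c x \<le> R" for c
    using R[of "c - t"] by (auto simp: dist_norm algebra_simps)
  ultimately show ?thesis unfolding delone_iff by (intro conjI exI[of _ r] exI[of _ R]) auto
qed

lemma orbit_closure_iff:
  fixes X Y :: "'a::euclidean_space set"
  assumes "delone X"
  shows "Y \<in> orbit_closure X \<longleftrightarrow>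
    closed Y \<and> (\<forall>k\<ge>1. \<forall>\<epsilon>>0. \<exists>t. \<exists>\<delta>>0. \<delta> < \<epsilon> \<and> local_close k Y ((\<lambda>x. x + t) ` X) \<delta>)"
proof -
  have cl: "closed ((\<lambda>x. x + t) ` X)" for t
    using delone_imp_closed delone_translate[OF assms] by blast
  have nbhd: "(\<forall>U. openin natural_topology U \<and> Y \<in> U \<longrightarrow> (\<exists>Z\<in>translation_orbit X. Z \<in> U)) \<longleftrightarrow>
    (\<forall>k\<ge>1. \<forall>\<epsilon>>0. \<exists>Z\<in>translation_orbit X. Z \<in> basic_nbhd Y k \<epsilon>)" if "closed Y"
    using natural_topology_nbhd_basis[OF that] by (smt (verit) order_refl subset_iff)
  have basic: "(\<forall>\<epsilon>>0. \<exists>Z\<in>translation_orbit X. Z \<in> basic_nbhd Y k \<epsilon>) \<longleftrightarrow>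
    (\<forall>\<epsilon>>0. \<exists>t. \<exists>\<delta>>0. \<delta> < \<epsilon> \<and> local_close k Y ((\<lambda>x. x + t) ` X) \<delta>)" (is "?l \<longleftrightarrow> ?r") for k
  proof
    assume l: ?l
    show ?r
    proof (intro allI impI)
      fix \<epsilon> :: real assume "\<epsilon> > 0"
      \<comment> \<open>\<open>local_dist\<close> never exceeds 1, so a neighbourhood of size above
        1 carries no information; the cap at 1 excludes this case.\<close>
      then have "min \<epsilon> 1 > 0" by simp
      with l obtain t where "(\<lambda>x. x + t) ` X \<in> basic_nbhd Y k (min \<epsilon> 1)"
        unfolding translation_orbit_def by blast
      then show "\<exists>t. \<exists>\<delta>>0. \<delta> < \<epsilon> \<and> local_close k Y ((\<lambda>x. x + t) ` X) \<delta>"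
        unfolding basic_nbhd_def local_dist_less_iff by auto
    qed
  next
    assume r: ?r
    show ?l
    proof (intro allI impI)
      fix \<epsilon> :: real assume "\<epsilon> > 0"
      with r obtain t where "\<exists>\<delta>>0. \<delta> < \<epsilon> \<and> local_close k Y ((\<lambda>x. x + t) ` X) \<delta>" by blast
      then have "(\<lambda>x. x + t) ` X \<in> basic_nbhd Y k \<epsilon>"
        unfolding basic_nbhd_def local_dist_less_iff using cl by simp
      then show "\<exists>Z\<in>translation_orbit X. Z \<in> basic_nbhd Y k \<epsilon>"
        unfolding translation_orbit_def by blast
    qed
  qed
  have "Y \<in> orbit_closure X \<longleftrightarrow> closed Y \<and>
    (\<forall>U. openin natural_topology U \<and> Y \<in> U \<longrightarrow> (\<exists>Z\<in>translation_orbit X. Z \<in> U))"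
    unfolding orbit_closure_def in_closure_of topspace_natural_topology by blast
  then show ?thesis using nbhd unfolding basic by meson
qed

lemma orbit_closure_approx:
  fixes X Y :: "'a::euclidean_space set"
  assumes "delone X" "Y \<in> orbit_closure X" "\<epsilon> > 0"
  obtains t where
    "\<And>y. y \<in> Y \<Longrightarrow> norm y \<le> K \<Longrightarrow> \<exists>x\<in>X. dist y (x + t) < \<epsilon>"
    "\<And>x. x \<in> X \<Longrightarrow> norm (x + t) \<le> K \<Longrightarrow> \<exists>y\<in>Y. dist y (x + t) < \<epsilon>"
proof -
  obtain k where k: "K \<le> real k" "k \<ge> 1"
    by (metis max.cobounded1 max.cobounded2 of_nat_le_iff order_trans real_arch_simple)
  obtain t \<delta> where t: "\<delta> < \<epsilon>" "local_close k Y ((\<lambda>x. x + t) ` X) \<delta>"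
    using assms(2,3) k(2) unfolding orbit_closure_iff[OF assms(1)] by blast
  show ?thesis
  proof
    fix y assume "y \<in> Y" "norm y \<le> K"
    then have "y \<in> Y \<inter> cball 0 (real k)" using k by auto
    then have "y \<in> (\<lambda>x. x + t) ` X + cball 0 \<delta>" using t(2) unfolding local_close_def by blast
    then show "\<exists>x\<in>X. dist y (x + t) < \<epsilon>" using t(1) unfolding minkowski_cball_iff by force
  next
    fix x assume "x \<in> X" "norm (x + t) \<le> K"
    then have "x + t \<in> (\<lambda>x. x + t) ` X \<inter> cball 0 (real k)" using k by auto
    then have "x + t \<in> Y + cball 0 \<delta>" using t(2) unfolding local_close_def by blast
    then show "\<exists>y\<in>Y. dist y (x + t) < \<epsilon>"
      using t(1) unfolding minkowski_cball_iff by (force simp: dist_commute)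
  qed
qed

lemma dist_diff_le: "dist (a - b) (c - d) \<le> dist a c + dist b (d::'a::real_normed_vector)"
  using norm_triangle_ineq4[of "a - c" "b - d"] by (simp add: dist_norm algebra_simps)

text \<open>The unknown translation \<open>t\<close> cancels in differences, so errors below
  \<epsilon> at two points give an error below 2\<epsilon> in their difference.\<close>

lemma dist_diff_translate_le:
  "dist (a - b) (c - d) \<le> dist a (c + t) + dist b (d + (t::'a::real_normed_vector))"
  using dist_diff_le[of a b "c + t" "d + t"] by simp

text \<open>Differences in \<open>X\<close> approximate \<open>y - y'\<close> arbitrarily well, but
  only finitely many of them lie near it, so one is equal to it.\<close>

lemma orbit_closure_differences:
  fixes X :: "'a::euclidean_space set"
  assumes X: "delone X" "finite_type X" and Y: "Y \<in> orbit_closure X" and y: "y \<in> Y" "y' \<in> Y"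
  shows "\<exists>a\<in>X. \<exists>b\<in>X. y - y' = a - b"
proof -
  define D where "D = {a - b | a b. a \<in> X \<and> b \<in> X} \<inter> cball 0 (norm (y - y') + 1)"
  have "finite D" using X(2) unfolding D_def finite_type_def by simp
  then obtain d where d: "d > 0" "\<And>w. w \<in> D \<Longrightarrow> w \<noteq> y - y' \<Longrightarrow> d \<le> dist (y - y') w"
    using finite_set_avoid[of D "y - y'"] by blast
  define \<epsilon> where "\<epsilon> = min d 1 / 2"
  have "\<epsilon> > 0" using d(1) by (simp add: \<epsilon>_def)
  then obtain t where
    t: "\<And>z. z \<in> Y \<Longrightarrow> norm z \<le> max (norm y) (norm y') \<Longrightarrow> \<exists>x\<in>X. dist z (x + t) < \<epsilon>"
    using orbit_closure_approx[OF X(1) Y] by metis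
  obtain a b where ab: "a \<in> X" "b \<in> X" "dist y (a + t) < \<epsilon>" "dist y' (b + t) < \<epsilon>"
    using t[OF y(1)] t[OF y(2)] by auto
  have close: "dist (y - y') (a - b) < 2 * \<epsilon>"
    using dist_diff_translate_le[of y y' a b t] ab by linarith
  moreover have "norm (a - b) \<le> norm (y - y') + dist (y - y') (a - b)"
    by (metis dist_norm norm_minus_commute norm_triangle_sub)
  ultimately have "a - b \<in> D" using ab unfolding D_def \<epsilon>_def by auto
  then have "a - b = y - y'" using d(2)[of "a - b"] close unfolding \<epsilon>_def by linarith
  with ab show ?thesis by metis
qed

text \<open>Separation is inherited with the same \<open>r\<close>, since differences in
  \<open>Y\<close> are differences in \<open>X\<close>; the covering radius grows by the
  approximation error, taken to be 1.\<close>

lemma orbit_closure_delone: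
  fixes X :: "'a::euclidean_space set"
  assumes X: "delone X" "finite_type X" and Y: "Y \<in> orbit_closure X"
  shows "delone Y"
proof -
  obtain r R where rR: "r > 0" "R > 0"
    and sep: "\<And>x y. x \<in> X \<Longrightarrow> y \<in> X \<Longrightarrow> dist x y < r \<Longrightarrow> x = y"
    and dense: "\<And>c. \<exists>x\<in>X. dist c x \<le> R"
    using X(1) unfolding delone_iff by blast
  have "x = y" if "x \<in> Y" "y \<in> Y" "dist x y < r" for x y
    using orbit_closure_differences[OF X Y that(1,2)] sep that(3)
    by (metis dist_norm eq_iff_diff_eq_0)
  moreover have "\<exists>y\<in>Y. dist c y \<le> R + 1" for c
  proof -
    obtain t where
      t: "\<And>x. x \<in> X \<Longrightarrow> norm (x + t) \<le> norm c + R \<Longrightarrow> \<exists>y\<in>Y. dist y (x + t) < 1"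
      using orbit_closure_approx[OF X(1) Y, of 1] by (metis zero_less_one)
    obtain x where x: "x \<in> X" "dist (c - t) x \<le> R" using dense by blast
    have cx: "dist c (x + t) \<le> R" using x(2) by (simp add: dist_norm algebra_simps)
    have "norm (x + t) \<le> norm c + dist c (x + t)"
      by (metis dist_norm norm_minus_commute norm_triangle_sub)
    then obtain y where "y \<in> Y" "dist y (x + t) < 1" using t[OF x(1)] cx by force
    then show ?thesis using cx dist_triangle2[of c y "x + t"] by force
  qed
  ultimately show ?thesis unfolding delone_iff using rR
    by (intro conjI exI[of _ r] exI[of _ "R + 1"]) auto
qed

text \<open>A translate of \<open>X\<close> close to \<open>Y\<close> on a large ball has a point
  near \<open>y\<close>. Relative to these two base points, matching points have nearby differences,
  all in \<open>X - X\<close>, hence equal ones.\<close>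

lemma orbit_closure_atlas_subset:
  fixes X :: "'a::euclidean_space set"
  assumes X: "delone X" "finite_type X" and Y: "Y \<in> orbit_closure X"
  shows "atlas Y \<subseteq> atlas X"
  unfolding atlas_subset_iff[OF orbit_closure_delone[OF assms]]
proof (intro allI impI subsetI)
  fix T :: real and P
  assume T: "T > 0" and "P \<in> atlas_at Y T"
  then obtain y where y: "y \<in> Y" "P = patch Y y T" unfolding atlas_at_def by blast
  define D where "D = {a - b | a b. a \<in> X \<and> b \<in> X} \<inter> cball 0 (T + 1)"
  obtain d where d: "d > 0" "\<And>u v. u \<in> D \<Longrightarrow> v \<in> D \<Longrightarrow> dist u v < d \<Longrightarrow> u = v"
    using close_differences_eq[OF X(2), of "T + 1"] unfolding D_def by blast
  \<comment> \<open>The error of a difference is below 2\<epsilon>: the bound 1 keeps differences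
    within radius \<open>T + 1\<close>, and the bound \<open>d\<close> makes them equal.\<close>
  define \<epsilon> where "\<epsilon> = min d 1 / 2"
  have e: "\<epsilon> > 0" "2 * \<epsilon> \<le> 1" "2 * \<epsilon> \<le> d" using d(1) by (auto simp: \<epsilon>_def)
  obtain t where
    t1: "\<And>z. z \<in> Y \<Longrightarrow> norm z \<le> norm y + T + 1 \<Longrightarrow> \<exists>x\<in>X. dist z (x + t) < \<epsilon>" and
    t2: "\<And>x. x \<in> X \<Longrightarrow> norm (x + t) \<le> norm y + T + 1 \<Longrightarrow> \<exists>z\<in>Y. dist z (x + t) < \<epsilon>"
    using orbit_closure_approx[OF X(1) Y e(1), of "norm y + T + 1"] by metis
  obtain x where x: "x \<in> X" "dist y (x + t) < \<epsilon>" using t1[OF y(1)] T by auto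
  have diffY: "z - y \<in> {a - b | a b. a \<in> X \<and> b \<in> X}" if "z \<in> Y" for z
    using orbit_closure_differences[OF X Y that y(1)] by blast
  \<comment> \<open>The disjunction serves both inclusions between the patches: a bound
    \<open>T\<close> on either difference bounds the other by \<open>T + 1\<close>, which puts both
    in \<open>D\<close>.\<close>
  have same: "z - y = w - x"
    if "z \<in> Y" "w \<in> X" "dist z (w + t) < \<epsilon>" "norm (z - y) \<le> T \<or> norm (w - x) \<le> T" for z w
  proof -
    have close: "dist (z - y) (w - x) < 2 * \<epsilon>"
      using dist_diff_translate_le[of z y w x t] that(3) x(2) by linarith
    have "norm (z - y) \<le> norm (w - x) + dist (z - y) (w - x)"
      "norm (w - x) \<le> norm (z - y) + dist (z - y) (w - x)"
      by (metis dist_norm norm_minus_commute norm_triangle_sub)+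
    then have n: "norm (z - y) \<le> T + 1" "norm (w - x) \<le> T + 1"
      using that(4) close e(2) by linarith+
    have "z - y \<in> D" using diffY[OF that(1)] n(1) unfolding D_def by auto
    moreover have "w - x \<in> D" using that(2) x(1) n(2) unfolding D_def by auto
    ultimately show ?thesis using d(2) close e(3) by force
  qed
  have "patch Y y T = patch X x T"
    unfolding patch_eq_iff
  proof (intro allI impI iffI)
    fix v :: 'a assume v: "norm v \<le> T" and mem: "y + v \<in> Y"
    have "norm (y + v) \<le> norm y + T + 1" using norm_triangle_ineq[of y v] v by linarith
    then obtain w where w: "w \<in> X" "dist (y + v) (w + t) < \<epsilon>" using t1[OF mem] by blast
    then have "y + v - y = w - x" using same[OF mem] v by simp
    then show "x + v \<in> X" using w(1) by simp
  next
    fix v :: 'a assume v: "norm v \<le> T" and mem: "x + v \<in> X"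
    have "x + v + t = y + v + (x + t - y)" by simp
    then have "norm (x + v + t) \<le> norm y + norm v + dist y (x + t)"
      by (metis dist_commute dist_norm norm_triangle_ineq add_right_mono order_trans)
    then have "norm (x + v + t) \<le> norm y + T + 1" using v x(2) e by linarith
    then obtain z where z: "z \<in> Y" "dist z (x + v + t) < \<epsilon>" using t2[OF mem] by blast
    then have "z - y = x + v - x" using same[OF z(1) mem] v by simp
    then have "z = y + v" by (simp add: algebra_simps)
    then show "y + v \<in> Y" using z(1) by simp
  qed
  then show "P \<in> atlas_at X T" using x y unfolding atlas_at_def by blast
qed

lemma atlas_subset_imp_orbit_closure:
  fixes X :: "'a::euclidean_space set"
  assumes X: "delone X" and Y: "delone Y" "atlas Y \<subseteq> atlas X"
  shows "Y \<in> orbit_closure X"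
  unfolding orbit_closure_iff[OF X]
proof (intro conjI allI impI)
  show "closed Y" by (rule delone_imp_closed[OF Y(1)])
  fix k :: nat and \<epsilon> :: real assume k: "k \<ge> 1" and e: "\<epsilon> > 0"
  obtain y where y: "y \<in> Y" using delone_nonempty[OF Y(1)] by blast
  \<comment> \<open>A patch of this radius around \<open>y\<close> covers the ball of radius
    \<open>k\<close> about the origin, so the translate of \<open>X\<close> by \<open>y - x\<close>
    agrees with \<open>Y\<close> exactly there.\<close>
  define T where "T = norm y + real k"
  have "T > 0" using k by (simp add: T_def add_nonneg_pos)
  then have "patch Y y T \<in> atlas_at X T"
    using Y y unfolding atlas_subset_iff[OF Y(1)] atlas_at_def by blast
  then obtain x where x: "x \<in> X" "patch Y y T = patch X x T" unfolding atlas_at_def by blast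
  have "z \<in> Y \<longleftrightarrow> z \<in> (\<lambda>a. a + (y - x)) ` X" if "norm z \<le> real k" for z
  proof -
    have "norm (z - y) \<le> T" using norm_triangle_ineq4[of z y] that unfolding T_def by linarith
    then have "y + (z - y) \<in> Y \<longleftrightarrow> x + (z - y) \<in> X" using x(2) unfolding patch_eq_iff by blast
    moreover have "x + (z - y) \<in> X \<longleftrightarrow> z \<in> (\<lambda>a. a + (y - x)) ` X"
      by (auto simp: image_iff algebra_simps intro!: bexI[of _ "x + (z - y)"])
    ultimately show ?thesis by simp
  qed
  then have "Y \<inter> cball 0 (real k) = (\<lambda>a. a + (y - x)) ` X \<inter> cball 0 (real k)"
    unfolding set_eq_iff Int_iff mem_cball_0 by blast
  moreover have "Z \<inter> cball 0 (real k) \<subseteq> Z + cball 0 (\<epsilon> / 2)" for Z :: "'a set"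
    unfolding subset_iff minkowski_cball_iff using e by force
  ultimately have "local_close k Y ((\<lambda>a. a + (y - x)) ` X) (\<epsilon> / 2)"
    unfolding local_close_def by metis
  then show "\<exists>t. \<exists>\<delta>>0. \<delta> < \<epsilon> \<and> local_close k Y ((\<lambda>x. x + t) ` X) \<delta>"
    using e by (intro exI[of _ "y - x"] exI[of _ "\<epsilon> / 2"]) auto
qed

lemma orbit_closure_eq:
  assumes "delone X" "finite_type X"
  shows "orbit_closure X = {Y. delone Y \<and> atlas Y \<subseteq> atlas X}"
  using assms orbit_closure_delone orbit_closure_atlas_subset atlas_subset_imp_orbit_closure
  by blast

text \<open>Each \<open>Y\<close> in the orbit closure is again Delone of finite type, so its own
  orbit closure is described by its atlas. Equal closures then contain each other's generating sets,
  which makes the atlases equal.\<close>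

lemma minimal_system_iff:
  assumes X: "delone X" "finite_type X"
  shows "minimal_system X \<longleftrightarrow> (\<forall>Y. delone Y \<longrightarrow> atlas Y \<subseteq> atlas X \<longrightarrow> atlas Y = atlas X)"
proof -
  have cl: "orbit_closure Y = {Z. delone Z \<and> atlas Z \<subseteq> atlas Y}"
    if "delone Y" "atlas Y \<subseteq> atlas X" for Y
    by (rule orbit_closure_eq[OF that(1) finite_type_subset[OF X(2)]])
      (rule atlas_subset_imp_differences[OF that])
  have "orbit_closure Y = orbit_closure X \<longleftrightarrow> atlas Y = atlas X"
    if "delone Y" "atlas Y \<subseteq> atlas X" for Y
    unfolding cl[OF that] orbit_closure_eq[OF X] using that X(1) by blast
  then show ?thesis
    unfolding minimal_system_def by (auto simp: orbit_closure_eq[OF X])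
qed

section \<open>Repetitivity and minimality\<close>

lemma repetitive_imp_atlas_eq:
  assumes rep: "repetitive X" and Y: "delone X" "delone Y" "atlas Y \<subseteq> atlas X"
  shows "atlas X \<subseteq> atlas Y"
  unfolding atlas_subset_iff[OF Y(1)]
proof (intro allI impI subsetI)
  fix T :: real and P assume T: "T > 0" and P: "P \<in> atlas_at X T"
  obtain M where "M > 0" "\<forall>c. \<forall>P\<in>atlas_at X T. \<exists>x\<in>X \<inter> cball c M. patch X x T = P"
    using rep T unfolding repetitive_def by meson
  then have M: "M > 0" "\<And>c. \<exists>x\<in>X \<inter> cball c M. patch X x T = P" using P by simp_all
  obtain y where y: "y \<in> Y" using delone_nonempty[OF Y(2)] by blast
  \<comment> \<open>Radius \<open>M + T\<close> contains the whole \<open>T\<close>-patch around any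
    centre at distance at most \<open>M\<close>.\<close>
  have "atlas_at Y (M + T) \<subseteq> atlas_at X (M + T)"
    using Y(3) M(1) T unfolding atlas_subset_iff[OF Y(2)] by simp
  then have "patch Y y (M + T) \<in> atlas_at X (M + T)"
    using y unfolding atlas_at_def by blast
  then obtain x where x: "patch X x (M + T) = patch Y y (M + T)"
    unfolding atlas_at_def by auto
  obtain x' where x': "x' \<in> X" "dist x x' \<le> M" "patch X x' T = P" using M(2)[of x] by auto
  have v: "norm (x' - x) \<le> M" using x'(2) by (simp add: dist_norm norm_minus_commute)
  then have "patch X (x + (x' - x)) T = patch Y (y + (x' - x)) T"
    by (intro patch_eq_subpatch[OF x]) simp
  moreover have "y + (x' - x) \<in> Y"
  proof -
    have "norm (x' - x) \<le> M + T" using v T by simp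
    then have "x + (x' - x) \<in> X \<longleftrightarrow> y + (x' - x) \<in> Y" using x unfolding patch_eq_iff by blast
    then show ?thesis using x'(1) by simp
  qed
  ultimately show "P \<in> atlas_at Y T" using x'(3) unfolding atlas_at_def by auto
qed

text \<open>Sharpens the bare negation twice: one \<open>P\<close> works for all \<open>M\<close>,
  because there are finitely many patches of radius \<open>T\<close>, and the balls are centred at
  points of \<open>X\<close>, at the cost of \<open>R\<close> in the radius.\<close>

lemma not_repetitive_missing_patch:
  fixes X :: "'a::euclidean_space set"
  assumes X: "delone X" "finite_type X" and "\<not> repetitive X"
  obtains T P where "T > 0" "P \<in> atlas_at X T"
    "\<And>M. \<exists>x\<in>X. \<forall>x'\<in>X \<inter> cball x M. patch X x' T \<noteq> P"
proof -
  obtain T where T: "T > 0" and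
    bad: "\<And>M. M > 0 \<Longrightarrow> \<exists>c. \<exists>P\<in>atlas_at X T. \<forall>x\<in>X \<inter> cball c M. patch X x T \<noteq> P"
    using assms(3) unfolding repetitive_def by metis
  have "\<exists>P\<in>atlas_at X T. \<forall>M. \<exists>c. \<forall>x\<in>X \<inter> cball c M. patch X x T \<noteq> P"
  proof (rule ccontr)
    assume "\<not> ?thesis"
    then obtain M where M: "\<And>P c. P \<in> atlas_at X T \<Longrightarrow> \<exists>x\<in>X \<inter> cball c (M P). patch X x T = P"
      by metis
    \<comment> \<open>If each patch had its own radius, the largest would serve all of them. The
      inserted 1 makes \<open>N\<close> positive, as \<open>bad\<close> requires.\<close>
    define N where "N = Max (insert 1 (M ` atlas_at X T))"
    have fin: "finite (insert 1 (M ` atlas_at X T))" using finite_atlas_at[OF X(2)] by simp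
    have "N \<ge> 1" unfolding N_def using fin by (intro Max_ge) auto
    then obtain c P where P: "P \<in> atlas_at X T" "\<forall>x\<in>X \<inter> cball c N. patch X x T \<noteq> P"
      using bad[of N] by auto
    have "M P \<le> N" unfolding N_def using fin P(1) by (intro Max_ge) auto
    then have "cball c (M P) \<subseteq> cball c N" by (rule subset_cball)
    then show False using M[OF P(1), of c] P(2) by blast
  qed
  then obtain P where P: "P \<in> atlas_at X T"
    "\<And>M. \<exists>c. \<forall>x\<in>X \<inter> cball c M. patch X x T \<noteq> P" by blast
  obtain R where R: "\<And>c. \<exists>x\<in>X. dist c x \<le> R" using X(1) unfolding delone_iff by blast
  have "\<exists>x\<in>X. \<forall>x'\<in>X \<inter> cball x M. patch X x' T \<noteq> P" for M
  proof -
    obtain c where c: "\<forall>x\<in>X \<inter> cball c (M + R). patch X x T \<noteq> P" using P(2) by blast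
    obtain x where x: "x \<in> X" "dist c x \<le> R" using R by blast
    have "cball x M \<subseteq> cball c (M + R)"
    proof
      fix z assume "z \<in> cball x M"
      then show "z \<in> cball c (M + R)" using x(2) dist_triangle[of c z x] by simp
    qed
    with c x(1) show ?thesis by blast
  qed
  with T P(1) that show ?thesis by blast
qed

text \<open>In the application \<open>B M x\<close> says that a fixed patch does not occur within distance \<open>M\<close> of \<open>x\<close>.\<close>

lemma patch_limit:
  fixes X :: "'a::euclidean_space set" and B :: "real \<Rightarrow> 'a \<Rightarrow> bool"
  assumes X: "finite_type X"
    and B: "\<And>M. \<exists>x\<in>X. B M x" and mono: "\<And>M M' x. M \<le> M' \<Longrightarrow> B M' x \<Longrightarrow> B M x"
  obtains Y where "\<And>N M. \<exists>x\<in>X. B M x \<and> patch Y 0 (real N) = patch X x (real N)"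
proof -
  \<comment> \<open>The good patches are the nodes of the tree in Koenig's lemma: they occur at
    points satisfying \<open>B M\<close> for every \<open>M\<close>.\<close>
  define good where "good N Q \<longleftrightarrow> (\<forall>M. \<exists>x\<in>X. B M x \<and> patch X x (real N) = Q)" for N Q
  \<comment> \<open>If every candidate patch failed from some \<open>M\<close> on, the largest of
    these finitely many thresholds would contradict \<open>ex\<close>. The predicate
    \<open>Z\<close> is used to require that the new patch extends the previous one.\<close>
  have pigeonhole: "\<exists>Q. good N Q \<and> Z Q"
    if ex: "\<And>M. \<exists>x\<in>X. B M x \<and> Z (patch X x (real N))" for N Z
  proof (rule ccontr)
    assume none: "\<nexists>Q. good N Q \<and> Z Q"
    let ?F = "{Q \<in> atlas_at X (real N). Z Q}"
    have "\<forall>Q\<in>?F. \<exists>M. \<forall>x\<in>X. B M x \<longrightarrow> patch X x (real N) \<noteq> Q"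
      using none unfolding good_def by blast
    then obtain m where m: "\<And>Q x. Q \<in> ?F \<Longrightarrow> x \<in> X \<Longrightarrow> B (m Q) x \<Longrightarrow> patch X x (real N) \<noteq> Q"
      by metis
    have fin: "finite ?F" using finite_atlas_at[OF X] by simp
    obtain x where x: "x \<in> X" "B (Max (insert 0 (m ` ?F))) x" "Z (patch X x (real N))"
      using ex by blast
    have Q: "patch X x (real N) \<in> ?F" using x unfolding atlas_at_def by blast
    have "m (patch X x (real N)) \<le> Max (insert 0 (m ` ?F))"
      using fin Q by (intro Max_ge) auto
    then show False using m[OF Q x(1)] mono x(2) by blast
  qed
  have "\<exists>Q. \<forall>N. good N (Q N) \<and> Q (Suc N) \<inter> cball 0 (real N) = Q N"
  proof (rule dependent_nat_choice)
    show "\<exists>Q. good 0 Q" using pigeonhole[of "\<lambda>_. True" 0] B by simp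
  next
    fix Q N assume Q: "good N Q"
    have "\<exists>x\<in>X. B M x \<and> patch X x (real (Suc N)) \<inter> cball 0 (real N) = Q" for M
      using Q patch_Int_cball[of "real N" "real (Suc N)" X] unfolding good_def by auto
    then show "\<exists>Q'. good (Suc N) Q' \<and> Q' \<inter> cball 0 (real N) = Q"
      using pigeonhole[of "\<lambda>Q'. Q' \<inter> cball 0 (real N) = Q" "Suc N"] by blast
  qed
  then obtain Q where good: "\<And>N. good N (Q N)"
    and step: "\<And>N. Q (Suc N) \<inter> cball 0 (real N) = Q N" by blast
  have nested: "Q (N + j) \<inter> cball 0 (real N) = Q N" for N j
  proof (induction j)
    case 0
    obtain x where "patch X x (real N) = Q N" using good unfolding good_def by blast
    then show ?case using patch_Int_cball[of "real N" "real N" X x] by simp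
  next
    case (Suc j)
    have "cball (0::'a) (real N) \<subseteq> cball 0 (real (N + j))" by auto
    then show ?case using Suc step[of "N + j"] by auto
  qed
  have cut: "Q L \<inter> cball 0 (real N) \<subseteq> Q N" for L N
  proof (cases "N \<le> L")
    case True
    then show ?thesis using nested[of N "L - N"] by simp
  next
    case False
    then show ?thesis using nested[of L "N - L"] by auto
  qed
  \<comment> \<open>By \<open>cut\<close>, no member of the union adds a point to \<open>Q N\<close>
    inside the ball of radius \<open>N\<close>.\<close>
  define Y where "Y = (\<Union>L. Q L)"
  have YQ: "patch Y 0 (real N) = Q N" for N
  proof -
    have "patch Y 0 (real N) = Y \<inter> cball 0 (real N)" by (auto simp: mem_patch_iff)
    also have "\<dots> = Q N" using cut[of _ N] nested[of N 0] unfolding Y_def by auto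
    finally show ?thesis .
  qed
  show ?thesis
  proof (rule that[of Y])
    show "\<exists>x\<in>X. B M x \<and> patch Y 0 (real N) = patch X x (real N)" for N M
      using good[of N] unfolding YQ good_def by metis
  qed
qed

text \<open>Each instance of the two Delone conditions concerns a bounded region, hence can be read
  off from one large patch of \<open>X\<close>; the constants \<open>r\<close> and \<open>R\<close>
  survive.\<close>

lemma delone_of_local_patches:
  fixes X :: "'a::euclidean_space set"
  assumes "delone X" and loc: "\<And>N. \<exists>x\<in>X. patch Y 0 (real N) = patch X x (real N)"
  shows "delone Y"
proof -
  obtain r R where rR: "r > 0" "R > 0"
    and sep: "\<And>x y. x \<in> X \<Longrightarrow> y \<in> X \<Longrightarrow> dist x y < r \<Longrightarrow> x = y"
    and dense: "\<And>c. \<exists>x\<in>X. dist c x \<le> R"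
    using assms(1) unfolding delone_iff by blast
  have loc': "\<exists>x\<in>X. \<forall>v. norm v \<le> K \<longrightarrow> (v \<in> Y \<longleftrightarrow> x + v \<in> X)" for K
  proof -
    obtain N where N: "K \<le> real N" using real_arch_simple by blast
    obtain x where "x \<in> X" "patch Y 0 (real N) = patch X x (real N)" using loc by blast
    then show ?thesis using N unfolding patch_eq_iff by auto
  qed
  have "y = z" if yz: "y \<in> Y" "z \<in> Y" "dist y z < r" for y z
  proof -
    obtain x where "x + y \<in> X" "x + z \<in> X"
      using loc'[of "max (norm y) (norm z)"] yz by (metis max.cobounded1 max.cobounded2)
    then show ?thesis using sep[of "x + y" "x + z"] yz(3) by simp
  qed
  moreover have "\<exists>y\<in>Y. dist c y \<le> R" for c
  proof -
    obtain x where x: "\<And>v. norm v \<le> norm c + R \<Longrightarrow> v \<in> Y \<longleftrightarrow> x + v \<in> X"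
      using loc'[of "norm c + R"] by blast
    obtain z where z: "z \<in> X" "dist (x + c) z \<le> R" using dense by blast
    have d: "dist c (z - x) \<le> R" using z(2) by (simp add: dist_norm algebra_simps)
    have "norm (z - x) \<le> norm c + dist c (z - x)"
      by (metis dist_norm norm_minus_commute norm_triangle_sub)
    then have "z - x \<in> Y" using x[of "z - x"] z(1) d by simp
    with d show ?thesis by blast
  qed
  ultimately show ?thesis unfolding delone_iff using rR
    by (intro conjI exI[of _ r] exI[of _ R]) auto
qed

lemma minimal_imp_repetitive:
  fixes X :: "'a::euclidean_space set"
  assumes X: "delone X" "finite_type X"
    and min: "\<And>Y. delone Y \<Longrightarrow> atlas Y \<subseteq> atlas X \<Longrightarrow> atlas Y = atlas X"
  shows "repetitive X"
proof (rule ccontr)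
  assume "\<not> repetitive X"
  then obtain T P where T: "T > 0" and P: "P \<in> atlas_at X T"
    and missing: "\<And>M. \<exists>x\<in>X. \<forall>x'\<in>X \<inter> cball x M. patch X x' T \<noteq> P"
    using not_repetitive_missing_patch[OF X] by blast
  define B where "B M x \<longleftrightarrow> (\<forall>x'\<in>X \<inter> cball x M. patch X x' T \<noteq> P)" for M x
  have "B M x" if "M \<le> M'" "B M' x" for M M' x
    using that(2) subset_cball[OF that(1), of x] unfolding B_def by blast
  then obtain Y where "\<And>N M. \<exists>x\<in>X. B M x \<and> patch Y 0 (real N) = patch X x (real N)"
    using patch_limit[OF X(2), of B] missing unfolding B_def by blast
  then have Y: "\<exists>x\<in>X. (\<forall>x'\<in>X \<inter> cball x M. patch X x' T \<noteq> P) \<and>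
      patch Y 0 (real N) = patch X x (real N)" for N M
    unfolding B_def .
  have del: "delone Y" using delone_of_local_patches[OF X(1)] Y by meson
  \<comment> \<open>With exclusion radius \<open>norm y\<close> the point \<open>x + y\<close> is
    itself an excluded centre, so \<open>P\<close> cannot occur in \<open>Y\<close> at
    \<open>y\<close>. The free radius \<open>S\<close> also gives the inclusion of atlases.\<close>
  have local: "\<exists>x\<in>X. (\<forall>x'\<in>X \<inter> cball x (norm y). patch X x' T \<noteq> P) \<and>
      x + y \<in> X \<and> patch Y y S = patch X (x + y) S" if y: "y \<in> Y" "S > 0" for y S
  proof -
    obtain N where N: "norm y + S \<le> real N" using real_arch_simple by blast
    obtain x where x: "x \<in> X" "\<forall>x'\<in>X \<inter> cball x (norm y). patch X x' T \<noteq> P"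
      "patch Y 0 (real N) = patch X x (real N)" using Y by blast
    have "patch Y y S = patch X (x + y) S" using patch_eq_subpatch[OF x(3) N] by simp
    moreover have "x + y \<in> X"
      using x(3) y N unfolding patch_eq_iff by (auto dest!: spec[of _ y])
    ultimately show ?thesis using x by blast
  qed
  have "atlas Y \<subseteq> atlas X"
    unfolding atlas_subset_iff[OF del] using local unfolding atlas_at_def by blast
  then have "atlas X \<subseteq> atlas Y" using min[OF del] by simp
  then have "P \<in> atlas_at Y T" using P T unfolding atlas_subset_iff[OF X(1)] by blast
  then obtain y where y: "y \<in> Y" "P = patch Y y T" unfolding atlas_at_def by blast
  obtain x where x: "\<forall>x'\<in>X \<inter> cball x (norm y). patch X x' T \<noteq> P" "x + y \<in> X"
    "patch Y y T = patch X (x + y) T" using local[OF y(1) T] by blast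
  have "x + y \<in> X \<inter> cball x (norm y)" using x(2) by (simp add: dist_norm)
  with x y(2) show False by metis
qed

theorem theorem3p2:
  fixes X :: "(real ^ 'n) set"
  assumes "delone X" and "finite_type X"
  shows "(translation_minimal (li_class X) \<longleftrightarrow> minimal_system X) \<and>
         (minimal_system X \<longleftrightarrow> orbit_closure X = li_class X) \<and>
         (minimal_system X \<longleftrightarrow> repetitive X)"
proof (intro conjI)
  \<comment> \<open>The atlas criterion is the common form to which every condition is
    reduced.\<close>
  note min = minimal_system_iff[OF assms]
  show "translation_minimal (li_class X) \<longleftrightarrow> minimal_system X"
    unfolding min translation_minimal_def li_classes_def using assms(1)
    by (auto simp: li_le_li_class_iff li_class_eq_iff)
  show "minimal_system X \<longleftrightarrow> orbit_closure X = li_class X"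
    unfolding min orbit_closure_eq[OF assms] li_class_def by auto
  show "minimal_system X \<longleftrightarrow> repetitive X"
    unfolding min using minimal_imp_repetitive[OF assms] repetitive_imp_atlas_eq assms(1) by blast
qed

end
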